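(* For every $\kappa\in\mathbb R$ there exists a $CAT(\kappa)$ space which contains an infinite subset that, with the restricted metric, fails the LTP.
   Context: A metric space $(M,d)$ has the long trapezoid property (LTP) if for each finite subset $N\subseteq M$ and each $\varepsilon>0$ there exist $u,v\in M$, $u\neq v$, such that $(1-\varepsilon)(d(x,y)+d(u,v))\leq d(x,u)+d(y,v)$ holds for all $x,y\in N$; it fails the LTP if it does not have it. $CAT(\kappa)$ spaces are understood in the standard sense (geodesic metric spaces, for $\kappa>0$ geodesic at distances less than $\pi/\sqrt\kappa$, in which geodesic triangles, of perimeter less than $2\pi/\sqrt{\kappa}$ if $\kappa>0$, are no thicker than their comparison triangles in the simply connected model surface of constant curvature $\kappa$). *)

theory Defs
  imports "HOL-Analysis.Analysis"
begin

definition long_trapezoid_property :: "'a set \<Rightarrow> ('a \<Rightarrow> 'a \<Rightarrow> real) \<Rightarrow> bool" where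
  "long_trapezoid_property M d \<longleftrightarrow>
     (\<forall>N. finite N \<and> N \<subseteq> M \<longrightarrow>
       (\<forall>\<epsilon>>0. \<exists>u\<in>M. \<exists>v\<in>M. u \<noteq> v \<and>
         (\<forall>x\<in>N. \<forall>y\<in>N. (1 - \<epsilon>) * (d x y + d u v) \<le> d x u + d y v)))"

text \<open>
  The model surface of constant curvature \<open>\<kappa>\<close>: the Euclidean plane, the unit sphere,
  or the upper sheet of the hyperboloid in Minkowski space, all as subsets of \<open>real ^ 3\<close>. The
  spherical metric (\<open>cos d = x \<bullet> y\<close>) and the hyperbolic metric
  (\<open>cosh d = - B x y\<close>, with \<open>B\<close> the Lorentz form) are rescaled by
  \<open>1 / sqrt \<bar>\<kappa>\<bar>\<close>.
\<close>

definition lorentz_form :: "real ^ 3 \<Rightarrow> real ^ 3 \<Rightarrow> real" where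
  "lorentz_form x y = x $ 1 * y $ 1 + x $ 2 * y $ 2 - x $ 3 * y $ 3"

definition model_surface :: "real \<Rightarrow> (real ^ 3) set" where
  "model_surface \<kappa> =
     (if \<kappa> = 0 then {x. x $ 3 = 0}
      else if \<kappa> > 0 then sphere 0 1
      else {x. lorentz_form x x = - 1 \<and> x $ 3 > 0})"

definition model_dist :: "real \<Rightarrow> real ^ 3 \<Rightarrow> real ^ 3 \<Rightarrow> real" where
  "model_dist \<kappa> x y =
     (if \<kappa> = 0 then dist x y
      else if \<kappa> > 0 then arccos (x \<bullet> y) / sqrt \<kappa>
      else arcosh (- lorentz_form x y) / sqrt (- \<kappa>))"

text \<open>
  Geodesics are parametrised by arc length on \<open>{0..d x y}\<close>; the values of \<open>c\<close> outside this
  interval are irrelevant.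
\<close>

definition geodesic_path ::
  "'a set \<Rightarrow> ('a \<Rightarrow> 'a \<Rightarrow> real) \<Rightarrow> 'a \<Rightarrow> 'a \<Rightarrow> (real \<Rightarrow> 'a) \<Rightarrow> bool" where
  "geodesic_path M d x y c \<longleftrightarrow>
     c ` {0..d x y} \<subseteq> M \<and> c 0 = x \<and> c (d x y) = y \<and>
     (\<forall>s\<in>{0..d x y}. \<forall>t\<in>{0..d x y}. d (c s) (c t) = \<bar>s - t\<bar>)"

definition geodesic_triangle ::
  "'a set \<Rightarrow> ('a \<Rightarrow> 'a \<Rightarrow> real) \<Rightarrow> 'a \<Rightarrow> 'a \<Rightarrow> 'a \<Rightarrow>
   (real \<Rightarrow> 'a) \<Rightarrow> (real \<Rightarrow> 'a) \<Rightarrow> (real \<Rightarrow> 'a) \<Rightarrow> bool" where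
  "geodesic_triangle M d x y z a b c \<longleftrightarrow>
     x \<in> M \<and> y \<in> M \<and> z \<in> M \<and>
     geodesic_path M d x y a \<and> geodesic_path M d y z b \<and> geodesic_path M d z x c"

text \<open>
  The set \<open>R\<close> below consists of all pairs of a point of the triangle and a comparison point
  for it: the comparison point lies on the corresponding side, at the same distance from the
  endpoints of that side.
\<close>

definition no_thicker_than_comparison ::
  "real \<Rightarrow> ('a \<Rightarrow> 'a \<Rightarrow> real) \<Rightarrow> 'a \<Rightarrow> 'a \<Rightarrow> 'a \<Rightarrow>
   (real \<Rightarrow> 'a) \<Rightarrow> (real \<Rightarrow> 'a) \<Rightarrow> (real \<Rightarrow> 'a) \<Rightarrow> bool" where
  "no_thicker_than_comparison \<kappa> d x y z a b c \<longleftrightarrow>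
     (\<forall>x' y' z' a' b' c'.
        geodesic_triangle (model_surface \<kappa>) (model_dist \<kappa>) x' y' z' a' b' c' \<and>
        model_dist \<kappa> x' y' = d x y \<and> model_dist \<kappa> y' z' = d y z \<and>
        model_dist \<kappa> z' x' = d z x \<longrightarrow>
        (let R = (\<lambda>s. (a s, a' s)) ` {0..d x y} \<union> (\<lambda>s. (b s, b' s)) ` {0..d y z} \<union>
                 (\<lambda>s. (c s, c' s)) ` {0..d z x}
         in \<forall>(p, p')\<in>R. \<forall>(q, q')\<in>R. d p q \<le> model_dist \<kappa> p' q'))"

definition CAT_space :: "real \<Rightarrow> 'a set \<Rightarrow> ('a \<Rightarrow> 'a \<Rightarrow> real) \<Rightarrow> bool" where
  "CAT_space \<kappa> M d \<longleftrightarrow>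
     Metric_space M d \<and>
     (\<forall>x\<in>M. \<forall>y\<in>M. (\<kappa> > 0 \<longrightarrow> d x y < pi / sqrt \<kappa>) \<longrightarrow> (\<exists>c. geodesic_path M d x y c)) \<and>
     (\<forall>x y z a b c. geodesic_triangle M d x y z a b c \<and>
        (\<kappa> > 0 \<longrightarrow> d x y + d y z + d z x < 2 * pi / sqrt \<kappa>) \<longrightarrow>
        no_thicker_than_comparison \<kappa> d x y z a b c)"

end

(*
The long trapezoid property fails in a space in which all distances between distinct points equal
delta, except for one pair p, q at distance D > delta: take N = {p, q} and x, y among p, q.

For kappa > 0 such a space with delta = pi / sqrt kappa is itself CAT(kappa), since it has neither
short geodesics nor small triangles. For kappa <= 0 the subset {-e 0, e 0, e 1, e 2, ...}, e
orthonormal, of an infinite-dimensional Euclidean or hyperbolic space has these distances. There a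
point of a side is an explicit linear combination of the endpoints (in the hyperboloid model if
kappa < 0), with coefficients depending only on the distances. So its products with other such
points are determined by the side lengths, and triangles are isometric to their comparison
triangles. Completeness plays no role, so finitely supported sequences suffice.
*)

theory Submission
  imports Defs
begin

section \<open>An obstruction to the long trapezoid property\<close>

text \<open>For any u and v, the points p and q can be named x and y so that x = u or y = v wherever
  possible. Then \<open>d x u + d y v\<close> is at most 2\<delta>, while
  \<open>d x y + d u v\<close> is at least D + \<delta>, which exceeds 2\<delta>.\<close>

lemma not_long_trapezoid_property_one_large_distance:
  assumes pq: "p \<in> S" "q \<in> S" "p \<noteq> q"
    and D: "d p q = D" "d q p = D" and "0 < \<delta>" "\<delta> < D"
    and zero: "\<And>x. x \<in> S \<Longrightarrow> d x x = 0"
    and \<delta>: "\<And>x y. x \<in> S \<Longrightarrow> y \<in> S \<Longrightarrow> x \<noteq> y \<Longrightarrow> {x, y} \<noteq> {p, q} \<Longrightarrow> d x y = \<delta>"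
  shows "\<not> long_trapezoid_property S d"
proof
  assume ltp: "long_trapezoid_property S d"
  \<comment> \<open>This choice places \<open>(1 - \<epsilon>) * (D + \<delta>)\<close> halfway
    between 2\<delta> and D + \<delta>.\<close>
  define \<epsilon> where "\<epsilon> = (D - \<delta>) / (2 * (D + \<delta>))"
  have "\<epsilon> > 0" and \<epsilon>: "(1 - \<epsilon>) * (D + \<delta>) = (D + 3 * \<delta>) / 2" and "\<epsilon> < 1"
    using assms(6,7) by (auto simp: \<epsilon>_def field_simps)
  have large: "(1 - \<epsilon>) * (D + \<delta>) > 2 * \<delta>" "(1 - \<epsilon>) * (D + \<delta>) > 0" "(1 - \<epsilon>) * (D + D) > 0"
    using assms(6,7) \<epsilon> \<open>\<epsilon> < 1\<close> by auto
  have "\<exists>u\<in>S. \<exists>v\<in>S. u \<noteq> v \<and>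
      (\<forall>x\<in>{p, q}. \<forall>y\<in>{p, q}. (1 - \<epsilon>) * (d x y + d u v) \<le> d x u + d y v)"
    using ltp pq(1,2) \<open>\<epsilon> > 0\<close> unfolding long_trapezoid_property_def
    by (metis finite.emptyI finite.insertI empty_subsetI insert_subset)
  then obtain u v where uv: "u \<in> S" "v \<in> S" "u \<noteq> v"
    and le: "\<And>x y. x \<in> {p, q} \<Longrightarrow> y \<in> {p, q} \<Longrightarrow>
      (1 - \<epsilon>) * (d x y + d u v) \<le> d x u + d y v"
    by blast
  show False
  proof (cases "u \<in> {p, q}")
    case u: True
    show False
    proof (cases "v \<in> {p, q}")
      case True
      then have "d u v = D"
        using u D uv(3) by auto
      then show False
        using le[of u v] u True uv zero large by auto
    next
      case False
      define w where "w = (if u = p then q else p)"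
      have "w \<in> {p, q}" "d u w = D" "w \<in> S"
        using u D pq by (auto simp: w_def)
      moreover have "d u v = \<delta>" "d w v = \<delta>"
        using \<delta>[of u v] \<delta>[of w v] uv False \<open>w \<in> S\<close> \<open>w \<in> {p, q}\<close> by auto
      ultimately show False
        using le[of u w] u uv zero large assms(6) by auto
    qed
  next
    case u: False
    show False
    proof (cases "v \<in> {p, q}")
      case True
      define w where "w = (if v = p then q else p)"
      have "w \<in> {p, q}" "d w v = D" "w \<in> S"
        using True D pq by (auto simp: w_def)
      moreover have "d u v = \<delta>" "d w u = \<delta>"
        using \<delta>[of u v] \<delta>[of w u] uv u \<open>w \<in> S\<close> \<open>w \<in> {p, q}\<close> by auto
      ultimately show False
        using le[of w v] True uv zero large assms(6) by auto
    next
      case False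
      have "d u v = \<delta>" "d p u = \<delta>" "d q v = \<delta>"
        using \<delta>[of u v] \<delta>[of p u] \<delta>[of q v] uv u False pq by auto
      then show False
        using le[of p q] D large by auto
    qed
  qed
qed

section \<open>Transport of geodesics and of the CAT condition along isometries\<close>

lemma geodesic_path_image:
  assumes "geodesic_path N d' x y c" "g ` N \<subseteq> M" "x \<in> N" "y \<in> N"
    and "\<And>p q. p \<in> N \<Longrightarrow> q \<in> N \<Longrightarrow> d (g p) (g q) = d' p q"
  shows "geodesic_path M d (g x) (g y) (g \<circ> c)"
  using assms unfolding geodesic_path_def by (auto simp: image_subset_iff)

lemma geodesic_triangle_image:
  assumes "geodesic_triangle N d' x y z a b c" "g ` N \<subseteq> M"
    and "\<And>p q. p \<in> N \<Longrightarrow> q \<in> N \<Longrightarrow> d (g p) (g q) = d' p q"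
  shows "geodesic_triangle M d (g x) (g y) (g z) (g \<circ> a) (g \<circ> b) (g \<circ> c)"
  using assms geodesic_path_image[of N d' _ _ _ g M d] unfolding geodesic_triangle_def by auto

text \<open>Geodesics are pulled back by the inverse of g, and triangles are pushed forward by g.
  This moves a space over an auxiliary type to the carrier type of the theorem.\<close>

lemma CAT_space_pullback:
  assumes g: "bij_betw g N M" and CAT: "CAT_space \<kappa> M d"
  shows "CAT_space \<kappa> N (\<lambda>x y. d (g x) (g y))"
proof -
  define h where "h = inv_into N g"
  have gN: "g ` N = M" and inj: "inj_on g N"
    using g by (auto simp: bij_betw_def)
  have h: "h z \<in> N" "g (h z) = z" if "z \<in> M" for z
    using that gN by (auto simp: h_def inv_into_into f_inv_into_f)
  have hg: "h (g x) = x" if "x \<in> N" for x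
    using that inj by (simp add: h_def)
  interpret M: Metric_space M d
    using CAT by (simp add: CAT_space_def)
  have "Metric_space N (\<lambda>x y. d (g x) (g y))"
    using gN by unfold_locales (auto simp: M.commute M.triangle inj_on_eq_iff[OF inj])
  moreover have "\<exists>c. geodesic_path N (\<lambda>x y. d (g x) (g y)) x y c"
    if xy: "x \<in> N" "y \<in> N" "\<kappa> > 0 \<longrightarrow> d (g x) (g y) < pi / sqrt \<kappa>" for x y
  proof -
    obtain c where "geodesic_path M d (g x) (g y) c"
      using CAT xy gN unfolding CAT_space_def by blast
    then have "geodesic_path N (\<lambda>x y. d (g x) (g y)) x y (h \<circ> c)"
      using xy unfolding geodesic_path_def
      by (auto simp: image_subset_iff h hg)
    then show ?thesis by blast
  qed
  moreover have "no_thicker_than_comparison \<kappa> (\<lambda>x y. d (g x) (g y)) x y z a b c"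
    if tri: "geodesic_triangle N (\<lambda>x y. d (g x) (g y)) x y z a b c"
      and per: "\<kappa> > 0 \<longrightarrow> d (g x) (g y) + d (g y) (g z) + d (g z) (g x) < 2 * pi / sqrt \<kappa>"
    for x y z a b c
  proof -
    have "geodesic_triangle M d (g x) (g y) (g z) (g \<circ> a) (g \<circ> b) (g \<circ> c)"
      using tri by (rule geodesic_triangle_image) (simp_all add: gN)
    then have "no_thicker_than_comparison \<kappa> d (g x) (g y) (g z) (g \<circ> a) (g \<circ> b) (g \<circ> c)"
      using CAT per unfolding CAT_space_def by blast
    \<comment> \<open>The comparison condition sees points of the space only through their
      distances, so both statements unfold to the same formula.\<close>
    then show ?thesis
      unfolding no_thicker_than_comparison_def Let_def ball_Un ball_simps prod.case comp_def .
  qed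
  ultimately show ?thesis
    unfolding CAT_space_def by blast
qed

text \<open>This is the set \<open>R\<close> of \<open>no_thicker_than_comparison\<close>. The
  second component has an arbitrary type, so comparison triangles may also lie outside
  \<open>real ^ 3\<close>.\<close>

definition corresponding_points ::
  "('a \<Rightarrow> 'a \<Rightarrow> real) \<Rightarrow> 'a \<Rightarrow> 'a \<Rightarrow> 'a \<Rightarrow>
   (real \<Rightarrow> 'a) \<Rightarrow> (real \<Rightarrow> 'a) \<Rightarrow> (real \<Rightarrow> 'a) \<Rightarrow>
   (real \<Rightarrow> 'b) \<Rightarrow> (real \<Rightarrow> 'b) \<Rightarrow> (real \<Rightarrow> 'b) \<Rightarrow> ('a \<times> 'b) set" where
  "corresponding_points d x y z a b c a' b' c' =
     (\<lambda>s. (a s, a' s)) ` {0..d x y} \<union> (\<lambda>s. (b s, b' s)) ` {0..d y z} \<union>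
     (\<lambda>s. (c s, c' s)) ` {0..d z x}"

lemma corresponding_points_cases:
  assumes "(p, p') \<in> corresponding_points d x y z a b c a' b' c'"
  obtains s where "s \<in> {0..d x y}" "p = a s" "p' = a' s"
    | s where "s \<in> {0..d y z}" "p = b s" "p' = b' s"
    | s where "s \<in> {0..d z x}" "p = c s" "p' = c' s"
  using assms unfolding corresponding_points_def by blast

lemma no_thicker_than_comparisonI:
  assumes "\<And>x' y' z' a' b' c' p p' q q'.
      \<lbrakk>geodesic_triangle (model_surface \<kappa>) (model_dist \<kappa>) x' y' z' a' b' c';
       model_dist \<kappa> x' y' = d x y; model_dist \<kappa> y' z' = d y z; model_dist \<kappa> z' x' = d z x;
       (p, p') \<in> corresponding_points d x y z a b c a' b' c';
       (q, q') \<in> corresponding_points d x y z a b c a' b' c'\<rbrakk>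
      \<Longrightarrow> d p q \<le> model_dist \<kappa> p' q'"
  shows "no_thicker_than_comparison \<kappa> d x y z a b c"
  unfolding no_thicker_than_comparison_def Let_def corresponding_points_def[symmetric]
  using assms by blast

section \<open>Positive curvature\<close>

lemma model_dist_nonneg_of_sphere:
  assumes "\<kappa> > 0" "p \<in> model_surface \<kappa>" "q \<in> model_surface \<kappa>"
  shows "0 \<le> model_dist \<kappa> p q"
proof -
  have "\<bar>p \<bullet> q\<bar> \<le> 1"
    using assms Cauchy_Schwarz_ineq2[of p q] by (simp add: model_surface_def)
  then show ?thesis
    using assms by (simp add: model_dist_def arccos_lbound abs_le_iff)
qed

text \<open>Both requirements become degenerate: points at distance less than
  \<open>pi / sqrt \<kappa>\<close> coincide, and a triangle of perimeter less than
  \<open>2 * pi / sqrt \<kappa>\<close> is a single point.\<close>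

lemma CAT_space_of_large_distances:
  assumes "\<kappa> > 0" "Metric_space M d"
    and large: "\<And>x y. x \<in> M \<Longrightarrow> y \<in> M \<Longrightarrow> x \<noteq> y \<Longrightarrow> pi / sqrt \<kappa> \<le> d x y"
  shows "CAT_space \<kappa> M d"
proof -
  interpret Metric_space M d by fact
  have "\<exists>c. geodesic_path M d x y c" if "x \<in> M" "y \<in> M" "d x y < pi / sqrt \<kappa>" for x y
  proof
    have "x = y"
      using that large[of x y] by auto
    then show "geodesic_path M d x y (\<lambda>_. x)"
      using that by (auto simp: geodesic_path_def)
  qed
  moreover have "no_thicker_than_comparison \<kappa> d x y z a b c"
    if tri: "geodesic_triangle M d x y z a b c"
      and per: "d x y + d y z + d z x < 2 * pi / sqrt \<kappa>" for x y z a b c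
  proof -
    have M: "x \<in> M" "y \<in> M" "z \<in> M"
      using tri by (auto simp: geodesic_triangle_def)
    \<comment> \<open>By the triangle inequality, a side is at most half the perimeter.\<close>
    have "d x y < pi / sqrt \<kappa>" "d y z < pi / sqrt \<kappa>"
      using per triangle[OF M(1,3,2)] triangle[OF M(2,1,3)] commute[of x y] commute[of y z]
        commute[of x z] by auto
    then have eq: "y = x" "z = x"
      using large[of x y] large[of y z] M by force+
    have d0: "d x x = 0" using M by simp
    show ?thesis
    proof (rule no_thicker_than_comparisonI)
      fix x' y' z' a' b' c' p p' q q'
      assume tri': "geodesic_triangle (model_surface \<kappa>) (model_dist \<kappa>) x' y' z' a' b' c'"
        and pq: "(p, p') \<in> corresponding_points d x y z a b c a' b' c'"
          "(q, q') \<in> corresponding_points d x y z a b c a' b' c'"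
      have "a 0 = x" "b 0 = x" "c 0 = x"
        using tri eq by (auto simp: geodesic_triangle_def geodesic_path_def)
      moreover have "a' 0 = x'" "b' 0 = y'" "c' 0 = z'"
        and "{x', y', z'} \<subseteq> model_surface \<kappa>"
        using tri' by (auto simp: geodesic_triangle_def geodesic_path_def)
      ultimately have "p = x" "q = x" "p' \<in> model_surface \<kappa>" "q' \<in> model_surface \<kappa>"
        using pq by (auto simp: corresponding_points_def eq d0)
      then show "d p q \<le> model_dist \<kappa> p' q'"
        using \<open>\<kappa> > 0\<close> by (simp add: d0 model_dist_nonneg_of_sphere)
    qed
  qed
  ultimately show ?thesis
    using assms unfolding CAT_space_def by blast
qed

lemma exists_CAT_space_failing_LTP_positive:
  assumes "\<kappa> > 0" "infinite (UNIV :: 'a set)"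
  shows "\<exists>d. CAT_space \<kappa> (UNIV :: 'a set) d \<and> \<not> long_trapezoid_property (UNIV :: 'a set) d"
proof -
  obtain p q :: 'a where "p \<noteq> q"
    using assms(2) by (metis (full_types) UNIV_eq_I finite.emptyI finite.insertI insertI1)
  define R where "R = pi / sqrt \<kappa>"
  have "R > 0" using assms by (simp add: R_def)
  \<comment> \<open>The triangle inequality holds because no distance exceeds twice the smallest
    positive one.\<close>
  define d where "d x y = (if x = y then 0 else if {x, y} = {p, q} then 2 * R else R)" for x y :: 'a
  have "Metric_space UNIV d"
    using \<open>R > 0\<close> by unfold_locales (auto simp: d_def insert_commute)
  then have "CAT_space \<kappa> UNIV d"
    using \<open>R > 0\<close> by (intro CAT_space_of_large_distances[OF assms(1)]) (auto simp: d_def R_def)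
  moreover have "\<not> long_trapezoid_property UNIV d"
    by (rule not_long_trapezoid_property_one_large_distance[of p _ q _ "2 * R" R])
      (use \<open>p \<noteq> q\<close> \<open>R > 0\<close> in \<open>auto simp: d_def insert_commute\<close>)
  ultimately show ?thesis by blast
qed

section \<open>Zero curvature\<close>

text \<open>Equality in the triangle inequality at \<open>c s\<close> forces \<open>x - c s\<close>
  and \<open>c s - y\<close> to point in the same direction, by strict convexity. Their lengths s
  and L - s then determine \<open>c s\<close>. If x = y, the only parameter is 0.\<close>

lemma geodesic_path_dist_eq:
  fixes x y :: "'a::real_inner"
  assumes "geodesic_path M dist x y c" "s \<in> {0..dist x y}"
  shows "c s = x + (s / dist x y) *\<^sub>R (y - x)"
proof (cases "x = y")
  case True
  then show ?thesis using assms by (auto simp: geodesic_path_def)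
next
  case False
  define L where "L = dist x y"
  have L: "L > 0" "0 \<le> s" "s \<le> L" using False assms by (auto simp: L_def)
  have *: "dist (c t) (c u) = \<bar>t - u\<bar>" if "t \<in> {0..L}" "u \<in> {0..L}" for t u
    using assms that by (simp add: geodesic_path_def L_def)
  have ends: "c 0 = x" "c L = y"
    using assms by (auto simp: geodesic_path_def L_def)
  have 1: "dist x (c s) = s" "dist (c s) y = L - s"
    using *[of 0 s] *[of s L] L ends by auto
  then have "norm (x - c s) *\<^sub>R (c s - y) = norm (c s - y) *\<^sub>R (x - c s)"
    using dist_triangle_eq[of x y "c s"] by (simp add: L_def)
  then have "s *\<^sub>R (c s - y) = (L - s) *\<^sub>R (x - c s)"
    using 1 by (simp add: dist_norm)
  then have "L *\<^sub>R c s = L *\<^sub>R x + s *\<^sub>R (y - x)"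
    by (simp add: algebra_simps)
  then have "c s = (1 / L) *\<^sub>R (L *\<^sub>R x + s *\<^sub>R (y - x))"
    using L by (metis (no_types) nonzero_divide_eq_eq less_irrefl scaleR_one scaleR_scaleR)
  then show ?thesis
    using L by (simp add: scaleR_add_right L_def[symmetric])
qed

lemma geodesic_path_segment:
  fixes x y :: "'a::real_inner"
  shows "geodesic_path UNIV dist x y (\<lambda>s. x + (s / dist x y) *\<^sub>R (y - x))"
proof (cases "x = y")
  case True
  then show ?thesis by (simp add: geodesic_path_def)
next
  case False
  have "dist (x + (s / dist x y) *\<^sub>R (y - x)) (x + (t / dist x y) *\<^sub>R (y - x)) = \<bar>s - t\<bar>" for s t
  proof -
    have "dist (x + (s / dist x y) *\<^sub>R (y - x)) (x + (t / dist x y) *\<^sub>R (y - x))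
        = norm (((s - t) / dist x y) *\<^sub>R (y - x))"
      by (simp add: dist_norm scaleR_left_diff_distrib diff_divide_distrib)
    then show ?thesis
      using False by (simp add: dist_norm norm_minus_commute)
  qed
  then show ?thesis
    using False by (auto simp: geodesic_path_def)
qed

text \<open>The difference of the two points is a combination of y - x and z - x, and by the law of
  cosines the Gram matrix of these vectors depends only on the side lengths.\<close>

lemma dist_affine_combinations_cong:
  fixes x y z :: "'a::real_inner" and x' y' z' :: "'b::real_inner"
  assumes "dist x' y' = dist x y" "dist y' z' = dist y z" "dist z' x' = dist z x"
  shows "dist (x + \<beta> *\<^sub>R (y - x) + \<gamma> *\<^sub>R (z - x)) (x + \<beta>' *\<^sub>R (y - x) + \<gamma>' *\<^sub>R (z - x)) =
    dist (x' + \<beta> *\<^sub>R (y' - x') + \<gamma> *\<^sub>R (z' - x')) (x' + \<beta>' *\<^sub>R (y' - x') + \<gamma>' *\<^sub>R (z' - x'))"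
proof -
  have expand: "(dist (u + \<beta> *\<^sub>R (v - u) + \<gamma> *\<^sub>R (w - u)) (u + \<beta>' *\<^sub>R (v - u) + \<gamma>' *\<^sub>R (w - u)))\<^sup>2 =
      (\<beta> - \<beta>')\<^sup>2 * (dist u v)\<^sup>2 + (\<gamma> - \<gamma>')\<^sup>2 * (dist w u)\<^sup>2
      + (\<beta> - \<beta>') * (\<gamma> - \<gamma>') * ((dist u v)\<^sup>2 + (dist w u)\<^sup>2 - (dist v w)\<^sup>2)"
    for u v w :: "'c::real_inner"
    unfolding dist_norm power2_norm_eq_inner
    by (simp add: inner_simps inner_commute algebra_simps power2_eq_square)
  show ?thesis
    by (rule power2_eq_imp_eq) (simp_all add: expand assms)
qed

text \<open>Corresponding points have the same affine coordinates with respect to the vertices, so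
  \<open>dist_affine_combinations_cong\<close> applies. The two ambient spaces may differ, which
  lets the plane inside \<open>real ^ 3\<close> be used directly.\<close>

lemma euclidean_comparison:
  fixes x y z :: "'a::real_inner" and x' y' z' :: "'b::real_inner"
  assumes tri: "geodesic_triangle M dist x y z a b c" "geodesic_triangle M' dist x' y' z' a' b' c'"
    and eq: "dist x' y' = dist x y" "dist y' z' = dist y z" "dist z' x' = dist z x"
    and pq: "(p, p') \<in> corresponding_points dist x y z a b c a' b' c'"
      "(q, q') \<in> corresponding_points dist x y z a b c a' b' c'"
  shows "dist p q = dist p' q'"
proof -
  have sides: "geodesic_path M dist x y a" "geodesic_path M dist y z b" "geodesic_path M dist z x c"
    "geodesic_path M' dist x' y' a'" "geodesic_path M' dist y' z' b'" "geodesic_path M' dist z' x' c'"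
    using tri by (simp_all add: geodesic_triangle_def)
  note formulas = sides[THEN geodesic_path_dist_eq]
  have "\<exists>\<beta> \<gamma>. p = x + \<beta> *\<^sub>R (y - x) + \<gamma> *\<^sub>R (z - x) \<and> p' = x' + \<beta> *\<^sub>R (y' - x') + \<gamma> *\<^sub>R (z' - x')"
    if "(p, p') \<in> corresponding_points dist x y z a b c a' b' c'" for p p'
    using that
  proof (cases rule: corresponding_points_cases)
    case (1 s)
    define t where "t = s / dist x y"
    have "p = x + t *\<^sub>R (y - x)" "p' = x' + t *\<^sub>R (y' - x')"
      using 1 formulas(1)[of s] formulas(4)[of s] by (simp_all add: eq t_def)
    then show ?thesis by (intro exI[of _ t] exI[of _ 0]) simp
  next
    case (2 s)
    define t where "t = s / dist y z"
    have "p = y + t *\<^sub>R (z - y)" "p' = y' + t *\<^sub>R (z' - y')"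
      using 2 formulas(2)[of s] formulas(5)[of s] by (simp_all add: eq t_def)
    then show ?thesis by (intro exI[of _ "1 - t"] exI[of _ t]) (simp add: algebra_simps)
  next
    case (3 s)
    define t where "t = s / dist z x"
    have "p = z + t *\<^sub>R (x - z)" "p' = z' + t *\<^sub>R (x' - z')"
      using 3 formulas(3)[of s] formulas(6)[of s] by (simp_all add: eq t_def)
    then show ?thesis by (intro exI[of _ 0] exI[of _ "1 - t"]) (simp add: algebra_simps)
  qed
  from this[OF pq(1)] this[OF pq(2)] show ?thesis
    by (elim exE conjE) (simp only: dist_affine_combinations_cong[OF eq])
qed

lemma CAT_space_real_inner: "CAT_space 0 (UNIV :: 'a::real_inner set) dist"
proof -
  have "no_thicker_than_comparison 0 dist x y z a b c"
    if tri: "geodesic_triangle UNIV dist x y z a b c" for x y z :: 'a and a b c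
  proof (rule no_thicker_than_comparisonI)
    fix x' y' z' a' b' c' p p' q q'
    have model: "model_dist 0 = dist"
      by (intro ext) (simp add: model_dist_def)
    assume "geodesic_triangle (model_surface 0) (model_dist 0) x' y' z' a' b' c'"
      "model_dist 0 x' y' = dist x y" "model_dist 0 y' z' = dist y z" "model_dist 0 z' x' = dist z x"
      "(p, p') \<in> corresponding_points dist x y z a b c a' b' c'"
      "(q, q') \<in> corresponding_points dist x y z a b c a' b' c'"
    from euclidean_comparison[OF tri this[unfolded model]]
    show "dist p q \<le> model_dist 0 p' q'"
      by (simp add: model)
  qed
  then show ?thesis
    unfolding CAT_space_def using geodesic_path_segment Met_TC.Metric_space_axioms by blast
qed

section \<open>Negative curvature\<close>

text \<open>
  The sign is chosen so that timelike vectors have positive square: \<open>mink\<close> is minus the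
  Lorentz form. The hyperboloid over an inner product space is parametrised by its spacelike
  coordinate.
\<close>

definition mink :: "'a::real_inner \<times> real \<Rightarrow> 'a \<times> real \<Rightarrow> real" where
  "mink p q = snd p * snd q - fst p \<bullet> fst q"

definition hyp_lift :: "'a::real_inner \<Rightarrow> 'a \<times> real" where
  "hyp_lift x = (x, sqrt (1 + x \<bullet> x))"

lemma mink_commute: "mink p q = mink q p"
  by (simp add: mink_def inner_commute)

lemma mink_swap: "mink p q = mink r s \<Longrightarrow> mink q p = mink s r"
  by (simp add: mink_commute)

lemma mink_linear:
  "mink (p + q) r = mink p r + mink q r" "mink r (p + q) = mink r p + mink r q"
  "mink (p - q) r = mink p r - mink q r" "mink r (p - q) = mink r p - mink r q"
  "mink (t *\<^sub>R p) r = t * mink p r" "mink r (t *\<^sub>R p) = t * mink r p"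
  by (simp_all add: mink_def inner_simps algebra_simps)

lemma fst_hyp_lift [simp]: "fst (hyp_lift x) = x"
  by (simp add: hyp_lift_def)

lemma one_plus_inner_pos: "0 < 1 + x \<bullet> (x::'a::real_inner)"
  by (simp add: add_pos_nonneg)

lemma snd_hyp_lift_power2: "(snd (hyp_lift x))\<^sup>2 = 1 + x \<bullet> x"
  using one_plus_inner_pos[of x] by (simp add: hyp_lift_def)

lemma mink_hyp_lift_self [simp]: "mink (hyp_lift x) (hyp_lift x) = 1"
  using snd_hyp_lift_power2[of x] by (simp add: mink_def power2_eq_square)

lemma snd_hyp_lift_pos: "0 < snd (hyp_lift x)"
  using one_plus_inner_pos[of x] by (simp add: hyp_lift_def)

text \<open>The two sides differ by the Cauchy-Schwarz defect of x and y. Keeping the term in x - y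
  yields both the bound \<open>mink_hyp_lift_ge_1\<close> and its equality case.\<close>

lemma mink_hyp_lift_bound:
  "(1 + x \<bullet> y)\<^sup>2 + (x - y) \<bullet> (x - y) \<le> (snd (hyp_lift x) * snd (hyp_lift y))\<^sup>2"
proof -
  have "(snd (hyp_lift x) * snd (hyp_lift y))\<^sup>2 = (1 + x \<bullet> x) * (1 + y \<bullet> y)"
    by (simp add: power_mult_distrib snd_hyp_lift_power2)
  also have "\<dots> = (1 + x \<bullet> y)\<^sup>2 + (x - y) \<bullet> (x - y) + ((x \<bullet> x) * (y \<bullet> y) - (x \<bullet> y)\<^sup>2)"
    by (simp add: inner_simps inner_commute algebra_simps power2_eq_square)
  finally show ?thesis
    using Cauchy_Schwarz_ineq[of x y] by simp
qed

lemma mink_hyp_lift_ge_1: "1 \<le> mink (hyp_lift x) (hyp_lift y)"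
proof -
  have "(1 + x \<bullet> y)\<^sup>2 \<le> (snd (hyp_lift x) * snd (hyp_lift y))\<^sup>2"
    using mink_hyp_lift_bound[of x y] inner_ge_zero[of "x - y"] by linarith
  then have "1 + x \<bullet> y \<le> snd (hyp_lift x) * snd (hyp_lift y)"
    by (rule power2_le_imp_le) (simp add: snd_hyp_lift_pos less_imp_le)
  then show ?thesis by (simp add: mink_def)
qed

lemma mink_hyp_lift_eq_1_iff: "mink (hyp_lift x) (hyp_lift y) = 1 \<longleftrightarrow> x = y"
proof
  assume "mink (hyp_lift x) (hyp_lift y) = 1"
  then have "snd (hyp_lift x) * snd (hyp_lift y) = 1 + x \<bullet> y"
    by (simp add: mink_def)
  then have "(x - y) \<bullet> (x - y) \<le> 0"
    using mink_hyp_lift_bound[of x y] by simp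
  then have "(x - y) \<bullet> (x - y) = 0"
    by (metis inner_ge_zero order_antisym)
  then show "x = y" by simp
qed simp

text \<open>A timelike u orthogonal to \<open>hyp_lift y\<close> would contradict Cauchy-Schwarz for
  y and \<open>fst u\<close>. This semidefiniteness is what the triangle inequality rests
  on.\<close>

lemma mink_nonpos_orthogonal:
  assumes "mink (hyp_lift y) u = 0"
  shows "mink u u \<le> 0"
proof (rule ccontr)
  assume "\<not> mink u u \<le> 0"
  then have less: "fst u \<bullet> fst u < (snd u)\<^sup>2"
    by (simp add: mink_def power2_eq_square)
  have "snd (hyp_lift y) * snd u = y \<bullet> fst u"
    using assms by (simp add: mink_def)
  then have "(1 + y \<bullet> y) * (snd u)\<^sup>2 = (y \<bullet> fst u)\<^sup>2"
    by (metis power_mult_distrib snd_hyp_lift_power2)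
  also have "\<dots> \<le> (y \<bullet> y) * (fst u \<bullet> fst u)"
    by (rule Cauchy_Schwarz_ineq)
  also have "\<dots> \<le> (y \<bullet> y) * (snd u)\<^sup>2"
    using less by (simp add: mult_left_mono)
  finally have "(snd u)\<^sup>2 \<le> 0"
    by (simp add: algebra_simps)
  with less inner_ge_zero[of "fst u"] show False by linarith
qed

lemma hyp_lift_fst:
  assumes "mink p p = 1" "0 < snd p"
  shows "hyp_lift (fst p) = p"
proof -
  have "1 + fst p \<bullet> fst p = (snd p)\<^sup>2"
    using assms(1) by (simp add: mink_def power2_eq_square)
  then show ?thesis
    using assms(2) by (simp add: hyp_lift_def prod_eq_iff)
qed

text \<open>Points on opposite sheets have a nonpositive product, by Cauchy-Schwarz. Thus the sign
  of one product decides the sheet, as is needed to apply \<open>hyp_lift_fst\<close> to points of a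
  geodesic.\<close>

lemma snd_pos_of_mink_pos:
  assumes "mink p p = 1" "0 < mink (hyp_lift x) p"
  shows "0 < snd p"
proof (rule ccontr)
  assume "\<not> 0 < snd p"
  have "(snd p)\<^sup>2 = 1 + fst p \<bullet> fst p"
    using assms(1) by (simp add: mink_def power2_eq_square)
  then have "(norm (fst p))\<^sup>2 \<le> \<bar>snd p\<bar>\<^sup>2"
    unfolding power2_abs power2_norm_eq_inner by linarith
  then have "norm (fst p) \<le> \<bar>snd p\<bar>"
    by (rule power2_le_imp_le) simp
  moreover have "(norm x)\<^sup>2 \<le> (snd (hyp_lift x))\<^sup>2"
    unfolding snd_hyp_lift_power2 power2_norm_eq_inner by linarith
  then have "norm x \<le> snd (hyp_lift x)"
    by (rule power2_le_imp_le) (simp add: snd_hyp_lift_pos less_imp_le)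
  ultimately have "norm x * norm (fst p) \<le> snd (hyp_lift x) * \<bar>snd p\<bar>"
    by (intro mult_mono) (auto simp: snd_hyp_lift_pos less_imp_le)
  then have "- (x \<bullet> fst p) \<le> - (snd (hyp_lift x) * snd p)"
    using Cauchy_Schwarz_ineq2[of x "fst p"] \<open>\<not> 0 < snd p\<close> by simp
  then show False
    using assms(2) by (simp add: mink_def)
qed

text \<open>
  After splitting off the components along \<open>hyp_lift y\<close>, the claim is the Cauchy-Schwarz
  inequality for the definite form on the orthogonal complement of \<open>hyp_lift y\<close>.
\<close>

lemma mink_triangle:
  assumes "mink (hyp_lift x) (hyp_lift y) = cosh a" "mink (hyp_lift y) (hyp_lift z) = cosh b"
    and "0 \<le> a" "0 \<le> b"
  shows "mink (hyp_lift x) (hyp_lift z) \<le> cosh (a + b)"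
proof (cases "a = 0 \<or> b = 0")
  case True
  then show ?thesis
    using assms mink_hyp_lift_eq_1_iff[of x y] mink_hyp_lift_eq_1_iff[of y z] by auto
next
  case False
  define X Y Z where "X = hyp_lift x" and "Y = hyp_lift y" and "Z = hyp_lift z"
  have XYZ: "mink X X = 1" "mink Y Y = 1" "mink Z Z = 1" "mink X Y = cosh a" "mink Y X = cosh a"
    "mink Y Z = cosh b" "mink Z Y = cosh b" "mink Z X = mink X Z"
    using assms by (simp_all add: X_def Y_def Z_def mink_commute)
  define u where "u = X - cosh a *\<^sub>R Y"
  define w where "w = Z - cosh b *\<^sub>R Y"
  have uw: "mink u u = - (sinh a)\<^sup>2" "mink w w = - (sinh b)\<^sup>2" "mink w u = mink u w"
    "mink Y u = 0" "mink Y w = 0"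
    using hyperbolic_pythagoras[of a] hyperbolic_pythagoras[of b]
    by (simp_all add: u_def w_def mink_linear XYZ power2_eq_square algebra_simps)
  have XZ: "mink X Z = cosh a * cosh b + mink u w"
    by (simp add: u_def w_def mink_linear XYZ algebra_simps)
  have "sinh a > 0" "sinh b > 0"
    using assms False by auto
  \<comment> \<open>The weights give both summands the same square
    \<open>- (sinh a * sinh b)\<^sup>2\<close>, so that \<open>mink v v \<le> 0\<close> bounds
    \<open>mink u w\<close> by exactly \<open>sinh a * sinh b\<close>.\<close>
  define v where "v = sinh b *\<^sub>R u + sinh a *\<^sub>R w"
  have "mink (hyp_lift y) v = 0"
    using uw by (simp add: v_def mink_linear flip: Y_def)
  then have "mink v v \<le> 0"
    by (rule mink_nonpos_orthogonal)
  also have "mink v v = 2 * (sinh a * sinh b) * (mink u w - sinh a * sinh b)"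
    by (simp add: v_def mink_linear uw power2_eq_square algebra_simps)
  finally have "mink u w \<le> sinh a * sinh b"
    using \<open>sinh a > 0\<close> \<open>sinh b > 0\<close> by (simp add: mult_le_0_iff)
  then show ?thesis
    using XZ by (simp add: cosh_add X_def Z_def)
qed

section \<open>The hyperbolic metric in spacelike coordinates\<close>

text \<open>The factor 1 / k corresponds to curvature \<open>- k\<^sup>2\<close>. Through the
  parametrisation by \<open>hyp_lift\<close>, the carrier is the whole inner product space.\<close>

definition hyp_dist :: "real \<Rightarrow> 'a::real_inner \<Rightarrow> 'a \<Rightarrow> real" where
  "hyp_dist k x y = arcosh (mink (hyp_lift x) (hyp_lift y)) / k"

lemma cosh_hyp_dist:
  assumes "k > 0"
  shows "cosh (k * hyp_dist k x y) = mink (hyp_lift x) (hyp_lift y)"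
  using assms mink_hyp_lift_ge_1[of x y] by (simp add: hyp_dist_def)

lemma hyp_dist_eqI:
  assumes "k > 0" "mink (hyp_lift x) (hyp_lift y) = cosh (k * t)"
  shows "hyp_dist k x y = \<bar>t\<bar>"
proof -
  have "cosh (k * t) = cosh (k * \<bar>t\<bar>)"
    by (metis abs_of_pos abs_mult assms(1) cosh_real_abs)
  then have "arcosh (mink (hyp_lift x) (hyp_lift y)) = k * \<bar>t\<bar>"
    using assms by (simp only: arcosh_cosh_real mult_nonneg_nonneg less_imp_le abs_ge_zero)
  then show ?thesis
    using assms(1) by (simp add: hyp_dist_def)
qed

lemma Metric_space_hyp_dist:
  assumes "k > 0"
  shows "Metric_space UNIV (hyp_dist k)"
proof
  fix x y z :: 'a
  show nonneg: "0 \<le> hyp_dist k x y" for x y :: 'a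
    using assms mink_hyp_lift_ge_1[of x y] by (simp add: hyp_dist_def)
  show "hyp_dist k x y = hyp_dist k y x"
    by (simp add: hyp_dist_def mink_commute)
  show "hyp_dist k x y = 0 \<longleftrightarrow> x = y"
    using assms mink_hyp_lift_ge_1[of x y] by (simp add: hyp_dist_def mink_hyp_lift_eq_1_iff)
  have "cosh (k * hyp_dist k x z) \<le> cosh (k * hyp_dist k x y + k * hyp_dist k y z)"
    using mink_triangle[of x y "k * hyp_dist k x y" z "k * hyp_dist k y z"] assms nonneg
    by (simp add: cosh_hyp_dist)
  then have "k * hyp_dist k x z \<le> k * (hyp_dist k x y + hyp_dist k y z)"
    using assms nonneg by (simp add: cosh_real_nonneg_le_iff distrib_left)
  then show "hyp_dist k x z \<le> hyp_dist k x y + hyp_dist k y z"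
    using assms by simp
qed

section \<open>Hyperbolic geodesics and their uniqueness\<close>

text \<open>This is \<open>cosh (k * s) *\<^sub>R X + sinh (k * s) *\<^sub>R E\<close> with X =
  \<open>hyp_lift x\<close> and E the normalised component of \<open>hyp_lift y\<close> orthogonal
  to X. For x = y the direction E degenerates, and the curve is of use at s = 0 only.\<close>

definition hyp_geodesic :: "real \<Rightarrow> 'a::real_inner \<Rightarrow> 'a \<Rightarrow> real \<Rightarrow> 'a \<times> real" where
  "hyp_geodesic k x y s = cosh (k * s) *\<^sub>R hyp_lift x +
     (sinh (k * s) / sinh (k * hyp_dist k x y)) *\<^sub>R
       (hyp_lift y - cosh (k * hyp_dist k x y) *\<^sub>R hyp_lift x)"

lemma hyp_geodesic_0 [simp]: "hyp_geodesic k x y 0 = hyp_lift x"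
  by (simp add: hyp_geodesic_def)

lemma sinh_hyp_dist_pos:
  assumes "k > 0" "x \<noteq> y"
  shows "0 < sinh (k * hyp_dist k x y)"
proof -
  interpret Metric_space UNIV "hyp_dist k :: 'a \<Rightarrow> 'a \<Rightarrow> real"
    by (rule Metric_space_hyp_dist[OF assms(1)])
  show ?thesis
    using assms zero[of x y] nonneg[of x y] by (simp add: less_le)
qed

lemma hyp_geodesic_hyp_dist:
  assumes "k > 0" "x \<noteq> y"
  shows "hyp_geodesic k x y (hyp_dist k x y) = hyp_lift y"
proof -
  have "sinh (k * hyp_dist k x y) / sinh (k * hyp_dist k x y) = 1"
    using sinh_hyp_dist_pos[OF assms] by (metis divide_self less_irrefl)
  then show ?thesis
    by (simp add: hyp_geodesic_def)
qed

text \<open>X and E are orthogonal with squares 1 and -1, so the claim is the subtraction formula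
  for cosh.\<close>

lemma mink_hyp_geodesic:
  assumes "k > 0" "x \<noteq> y"
  shows "mink (hyp_geodesic k x y s) (hyp_geodesic k x y t) = cosh (k * (s - t))"
proof -
  define L where "L = k * hyp_dist k x y"
  define X where "X = hyp_lift x"
  define E where "E = (1 / sinh L) *\<^sub>R (hyp_lift y - cosh L *\<^sub>R X)"
  have "sinh L > 0"
    using sinh_hyp_dist_pos[OF assms] by (simp add: L_def)
  have XY: "mink X (hyp_lift y) = cosh L" "mink (hyp_lift y) X = cosh L"
    using assms by (simp_all add: L_def X_def cosh_hyp_dist mink_commute)
  have "mink X X = 1" "mink X E = 0" "mink E X = 0"
    using XY by (simp_all add: E_def mink_linear X_def)
  moreover have "mink E E = - 1"
  proof -
    have "mink E E = (1 - (cosh L)\<^sup>2) / (sinh L)\<^sup>2"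
      using XY by (simp add: E_def mink_linear X_def power2_eq_square)
    then show ?thesis
      using \<open>sinh L > 0\<close> by (simp add: cosh_square_eq)
  qed
  moreover have "hyp_geodesic k x y r = cosh (k * r) *\<^sub>R X + sinh (k * r) *\<^sub>R E" for r
    by (simp add: hyp_geodesic_def E_def X_def L_def)
  ultimately show ?thesis
    by (simp add: mink_linear cosh_diff right_diff_distrib)
qed

lemma hyp_lift_fst_hyp_geodesic:
  assumes "k > 0" "x \<noteq> y"
  shows "hyp_lift (fst (hyp_geodesic k x y s)) = hyp_geodesic k x y s"
proof (rule hyp_lift_fst)
  show "mink (hyp_geodesic k x y s) (hyp_geodesic k x y s) = 1"
    by (simp add: mink_hyp_geodesic[OF assms])
  moreover have "0 < mink (hyp_lift x) (hyp_geodesic k x y s)"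
    using mink_hyp_geodesic[OF assms, of 0 s] by simp
  ultimately show "0 < snd (hyp_geodesic k x y s)"
    by (rule snd_pos_of_mink_pos)
qed

lemma geodesic_path_hyp_geodesic:
  assumes "k > 0" "x \<noteq> y"
  shows "geodesic_path UNIV (hyp_dist k) x y (\<lambda>s. fst (hyp_geodesic k x y s))"
proof -
  have "hyp_dist k (fst (hyp_geodesic k x y s)) (fst (hyp_geodesic k x y t)) = \<bar>s - t\<bar>" for s t
    by (rule hyp_dist_eqI)
      (simp_all add: assms(1) hyp_lift_fst_hyp_geodesic[OF assms] mink_hyp_geodesic[OF assms])
  then show ?thesis
    by (simp add: geodesic_path_def hyp_geodesic_hyp_dist[OF assms])
qed

text \<open>The distances from \<open>c s\<close> to x and y determine its product with the explicit
  point \<open>hyp_geodesic k x y s\<close>, a combination of the lifted endpoints. This product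
  equals 1, and on the hyperboloid that means the points coincide.\<close>

lemma geodesic_path_hyp_dist_eq:
  assumes "k > 0" "geodesic_path M (hyp_dist k) x y c" "s \<in> {0..hyp_dist k x y}"
  shows "hyp_lift (c s) = hyp_geodesic k x y s"
proof -
  interpret Metric_space UNIV "hyp_dist k :: 'a \<Rightarrow> 'a \<Rightarrow> real"
    by (rule Metric_space_hyp_dist[OF assms(1)])
  show ?thesis
  proof (cases "x = y")
    case True
    then show ?thesis
      using assms by (auto simp: geodesic_path_def)
  next
    case False
    define L where "L = hyp_dist k x y"
    have ends: "c 0 = x" "c L = y"
      using assms by (auto simp: geodesic_path_def L_def)
    have "0 \<le> s" "s \<le> L"
      using assms(3) by (auto simp: L_def)
    moreover have "hyp_dist k (c t) (c u) = \<bar>t - u\<bar>" if "t \<in> {0..L}" "u \<in> {0..L}" for t u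
      using assms that by (simp add: geodesic_path_def L_def)
    note this[of s 0] this[of s L]
    ultimately have "hyp_dist k (c s) x = s" "hyp_dist k (c s) y = L - s"
      by (simp_all add: ends)
    then have mink_ends: "mink (hyp_lift (c s)) (hyp_lift x) = cosh (k * s)"
      "mink (hyp_lift (c s)) (hyp_lift y) = cosh (k * L - k * s)"
      using cosh_hyp_dist[OF assms(1), of "c s" x] cosh_hyp_dist[OF assms(1), of "c s" y]
      by (simp_all add: right_diff_distrib)
    have "sinh (k * L) > 0"
      using sinh_hyp_dist_pos[OF assms(1) False] by (simp add: L_def)
    have "mink (hyp_lift (c s)) (hyp_geodesic k x y s) =
        (cosh (k * s))\<^sup>2 + sinh (k * s) / sinh (k * L) * (cosh (k * L - k * s) - cosh (k * L) * cosh (k * s))"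
      by (simp add: hyp_geodesic_def mink_linear mink_ends power2_eq_square flip: L_def)
    also have "\<dots> = (cosh (k * s))\<^sup>2 - (sinh (k * s))\<^sup>2"
    proof -
      have "cosh (k * L - k * s) - cosh (k * L) * cosh (k * s) = - (sinh (k * L) * sinh (k * s))"
        by (simp add: cosh_diff)
      then show ?thesis
        using less_imp_neq[OF \<open>sinh (k * L) > 0\<close>]
        by (simp only: power2_eq_square) (simp del: sinh_real_zero_iff)
    qed
    also have "\<dots> = 1"
      by (simp add: cosh_square_eq)
    finally have "c s = fst (hyp_geodesic k x y s)"
      using mink_hyp_lift_eq_1_iff hyp_lift_fst_hyp_geodesic[OF assms(1) False] by metis
    then show ?thesis
      using hyp_lift_fst_hyp_geodesic[OF assms(1) False] by simp
  qed
qed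

section \<open>Comparison of hyperbolic triangles\<close>

text \<open>Lifts of corresponding points have the same coefficients with respect to the lifted
  vertices. The products of these vertices are cosh of k times the side lengths, so both triangles
  have the same Gram matrix.\<close>

lemma hyperbolic_comparison:
  fixes x y z :: "'a::real_inner" and x' y' z' :: "'b::real_inner"
  assumes "k > 0"
    and tri: "geodesic_triangle M (hyp_dist k) x y z a b c"
      "geodesic_triangle M' (hyp_dist k) x' y' z' a' b' c'"
    and eq: "hyp_dist k x' y' = hyp_dist k x y" "hyp_dist k y' z' = hyp_dist k y z"
      "hyp_dist k z' x' = hyp_dist k z x"
    and pq: "(p, p') \<in> corresponding_points (hyp_dist k) x y z a b c a' b' c'"
      "(q, q') \<in> corresponding_points (hyp_dist k) x y z a b c a' b' c'"
  shows "hyp_dist k p q = hyp_dist k p' q'"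
proof -
  \<comment> \<open>These coefficients see the endpoints only through their distance d. For d = 0
    and s = 0, division by zero gives A = 1 and B = 0, as a constant side requires.\<close>
  define A where "A s d = cosh (k * s) - sinh (k * s) / sinh (k * d) * cosh (k * d)" for s d
  define B where "B s d = sinh (k * s) / sinh (k * d)" for s d
  have expand: "hyp_geodesic k v w s = A s (hyp_dist k v w) *\<^sub>R hyp_lift v + B s (hyp_dist k v w) *\<^sub>R hyp_lift w"
    for v w :: "'c::real_inner" and s
    by (simp add: hyp_geodesic_def A_def B_def scaleR_diff_right scaleR_diff_left)
  have sides: "geodesic_path M (hyp_dist k) x y a" "geodesic_path M (hyp_dist k) y z b"
    "geodesic_path M (hyp_dist k) z x c" "geodesic_path M' (hyp_dist k) x' y' a'"
    "geodesic_path M' (hyp_dist k) y' z' b'" "geodesic_path M' (hyp_dist k) z' x' c'"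
    using tri by (simp_all add: geodesic_triangle_def)
  note formulas = sides[THEN geodesic_path_hyp_dist_eq[OF assms(1)], unfolded expand]
  have "\<exists>\<alpha> \<beta> \<gamma>. hyp_lift p = \<alpha> *\<^sub>R hyp_lift x + \<beta> *\<^sub>R hyp_lift y + \<gamma> *\<^sub>R hyp_lift z \<and>
      hyp_lift p' = \<alpha> *\<^sub>R hyp_lift x' + \<beta> *\<^sub>R hyp_lift y' + \<gamma> *\<^sub>R hyp_lift z'"
    if "(p, p') \<in> corresponding_points (hyp_dist k) x y z a b c a' b' c'" for p p'
    using that
  proof (cases rule: corresponding_points_cases)
    case (1 s)
    then show ?thesis
      using formulas(1)[of s] formulas(4)[of s] eq
      by (intro exI[of _ "A s (hyp_dist k x y)"] exI[of _ "B s (hyp_dist k x y)"] exI[of _ 0]) simp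
  next
    case (2 s)
    then show ?thesis
      using formulas(2)[of s] formulas(5)[of s] eq
      by (intro exI[of _ 0] exI[of _ "A s (hyp_dist k y z)"] exI[of _ "B s (hyp_dist k y z)"]) simp
  next
    case (3 s)
    then show ?thesis
      using formulas(3)[of s] formulas(6)[of s] eq
      by (intro exI[of _ "B s (hyp_dist k z x)"] exI[of _ 0] exI[of _ "A s (hyp_dist k z x)"])
        (simp add: add.commute)
  qed
  note comb = this[OF pq(1)] this[OF pq(2)]
  have "mink (hyp_lift x') (hyp_lift y') = mink (hyp_lift x) (hyp_lift y)"
    "mink (hyp_lift y') (hyp_lift z') = mink (hyp_lift y) (hyp_lift z)"
    "mink (hyp_lift z') (hyp_lift x') = mink (hyp_lift z) (hyp_lift x)"
    using eq cosh_hyp_dist[OF assms(1)] by metis+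
  \<comment> \<open>Off-diagonal products in both orders; the diagonal ones are 1 by
    \<open>mink_hyp_lift_self\<close>.\<close>
  note gram = this this[THEN mink_swap]
  have "mink (hyp_lift p) (hyp_lift q) = mink (hyp_lift p') (hyp_lift q')"
    using comb by (elim exE conjE) (simp add: mink_linear gram)
  then show ?thesis
    by (simp add: hyp_dist_def)
qed

text \<open>
  This projection identifies the model surface with the hyperboloid over \<open>real \<times> real\<close>.
\<close>

definition spacelike_part :: "real ^ 3 \<Rightarrow> real \<times> real" where
  "spacelike_part v = (v $ 1, v $ 2)"

lemma hyp_dist_spacelike_part:
  assumes "\<kappa> < 0" "v \<in> model_surface \<kappa>" "w \<in> model_surface \<kappa>"
  shows "hyp_dist (sqrt (- \<kappa>)) (spacelike_part v) (spacelike_part w) = model_dist \<kappa> v w"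
proof -
  have lift: "hyp_lift (spacelike_part u) = ((u $ 1, u $ 2), u $ 3)" if "u \<in> model_surface \<kappa>" for u
    using that assms(1) hyp_lift_fst[of "((u $ 1, u $ 2), u $ 3)"]
    by (simp add: model_surface_def lorentz_form_def mink_def spacelike_part_def)
  have "mink (hyp_lift (spacelike_part v)) (hyp_lift (spacelike_part w)) = - lorentz_form v w"
    by (simp add: lift assms mink_def lorentz_form_def)
  then show ?thesis
    using assms(1) by (simp add: hyp_dist_def model_dist_def)
qed

lemma CAT_space_hyp_dist:
  assumes "\<kappa> < 0"
  shows "CAT_space \<kappa> (UNIV :: 'a::real_inner set) (hyp_dist (sqrt (- \<kappa>)))"
proof -
  define k where "k = sqrt (- \<kappa>)"
  have "k > 0" using assms by (simp add: k_def)
  interpret Metric_space "UNIV :: 'a set" "hyp_dist k"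
    by (rule Metric_space_hyp_dist[OF \<open>k > 0\<close>])
  have "\<exists>c. geodesic_path UNIV (hyp_dist k) x y c" for x y :: 'a
  proof (cases "x = y")
    case True
    then have "geodesic_path UNIV (hyp_dist k) x y (\<lambda>_. x)"
      by (simp add: geodesic_path_def)
    then show ?thesis by blast
  next
    case False
    then show ?thesis
      using geodesic_path_hyp_geodesic[OF \<open>k > 0\<close>] by blast
  qed
  moreover have "no_thicker_than_comparison \<kappa> (hyp_dist k) x y z a b c"
    if tri: "geodesic_triangle UNIV (hyp_dist k) x y z a b c" for x y z :: 'a and a b c
  proof (rule no_thicker_than_comparisonI)
    fix x' y' z' a' b' c' p p' q q'
    let ?f = spacelike_part
    note f = hyp_dist_spacelike_part[OF assms, folded k_def]
    assume tri': "geodesic_triangle (model_surface \<kappa>) (model_dist \<kappa>) x' y' z' a' b' c'"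
      and eq: "model_dist \<kappa> x' y' = hyp_dist k x y" "model_dist \<kappa> y' z' = hyp_dist k y z"
        "model_dist \<kappa> z' x' = hyp_dist k z x"
      and pq: "(p, p') \<in> corresponding_points (hyp_dist k) x y z a b c a' b' c'"
        "(q, q') \<in> corresponding_points (hyp_dist k) x y z a b c a' b' c'"
    have vertices: "x' \<in> model_surface \<kappa>" "y' \<in> model_surface \<kappa>" "z' \<in> model_surface \<kappa>"
      using tri' by (simp_all add: geodesic_triangle_def)
    \<comment> \<open>\<open>hyp_dist_spacelike_part\<close> holds on the model surface only, so
      comparison points must be known to lie there.\<close>
    have model: "v' \<in> model_surface \<kappa>"
      if "(v, v') \<in> corresponding_points (hyp_dist k) x y z a b c a' b' c'" for v v'
      using that tri' eq
      by (auto simp: corresponding_points_def geodesic_triangle_def geodesic_path_def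
          image_subset_iff)
    \<comment> \<open>The comparison triangle moves to \<open>real \<times> real\<close>, where both
      triangles are measured by \<open>hyp_dist\<close>.\<close>
    have "geodesic_triangle UNIV (hyp_dist k) (?f x') (?f y') (?f z') (?f \<circ> a') (?f \<circ> b') (?f \<circ> c')"
      using tri' by (rule geodesic_triangle_image) (simp_all add: f)
    moreover have "(p, ?f p') \<in> corresponding_points (hyp_dist k) x y z a b c (?f \<circ> a') (?f \<circ> b') (?f \<circ> c')"
      "(q, ?f q') \<in> corresponding_points (hyp_dist k) x y z a b c (?f \<circ> a') (?f \<circ> b') (?f \<circ> c')"
      using pq by (auto simp: corresponding_points_def)
    ultimately have "hyp_dist k p q = hyp_dist k (?f p') (?f q')"
      using f[OF vertices(1,2)] f[OF vertices(2,3)] f[OF vertices(3,1)] eq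
      by (intro hyperbolic_comparison[OF \<open>k > 0\<close> tri]) simp_all
    then show "hyp_dist k p q \<le> model_dist \<kappa> p' q'"
      using model pq by (simp add: f)
  qed
  ultimately show ?thesis
    unfolding CAT_space_def k_def[symmetric] using Metric_space_axioms by blast
qed

section \<open>An infinite-dimensional inner product space\<close>

text \<open>A type is introduced because the CAT results for \<kappa> \<le> 0 are stated for the
  class \<open>real_inner\<close>; the unit sequences supply infinitely many orthonormal
  vectors.\<close>

typedef fin_seq = "{f :: nat \<Rightarrow> real. finite {n. f n \<noteq> 0}}"
  morphisms coord Abs_fin_seq
  by (rule exI[of _ "\<lambda>_. 0"]) simp

setup_lifting type_definition_fin_seq

lemma finite_support_coord [simp]: "finite {n. coord x n \<noteq> 0}"
  using coord[of x] by simp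

instantiation fin_seq :: real_vector
begin

lift_definition zero_fin_seq :: fin_seq is "\<lambda>_. 0"
  by simp

lift_definition plus_fin_seq :: "fin_seq \<Rightarrow> fin_seq \<Rightarrow> fin_seq" is "\<lambda>f g n. f n + g n"
  by (drule (1) finite_UnI, erule rev_finite_subset) auto

lift_definition uminus_fin_seq :: "fin_seq \<Rightarrow> fin_seq" is "\<lambda>f n. - f n"
  by simp

lift_definition minus_fin_seq :: "fin_seq \<Rightarrow> fin_seq \<Rightarrow> fin_seq" is "\<lambda>f g n. f n - g n"
  by (drule (1) finite_UnI, erule rev_finite_subset) auto

lift_definition scaleR_fin_seq :: "real \<Rightarrow> fin_seq \<Rightarrow> fin_seq" is "\<lambda>r f n. r * f n"
  by (erule rev_finite_subset) auto

instance
  by standard (transfer; simp add: algebra_simps fun_eq_iff)+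

end

instantiation fin_seq :: real_inner
begin

definition inner_fin_seq :: "fin_seq \<Rightarrow> fin_seq \<Rightarrow> real" where
  "inner_fin_seq x y = (\<Sum>n | coord x n \<noteq> 0. coord x n * coord y n)"

definition norm_fin_seq :: "fin_seq \<Rightarrow> real" where
  "norm_fin_seq x = sqrt (inner x x)"

definition sgn_fin_seq :: "fin_seq \<Rightarrow> fin_seq" where
  "sgn_fin_seq x = x /\<^sub>R norm x"

definition dist_fin_seq :: "fin_seq \<Rightarrow> fin_seq \<Rightarrow> real" where
  "dist_fin_seq x y = norm (x - y)"

definition uniformity_fin_seq :: "(fin_seq \<times> fin_seq) filter" where
  "uniformity_fin_seq = (INF e\<in>{0<..}. principal {(x, y). dist x y < e})"

definition open_fin_seq :: "fin_seq set \<Rightarrow> bool" where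
  "open_fin_seq U \<longleftrightarrow> (\<forall>x\<in>U. eventually (\<lambda>(x', y). x' = x \<longrightarrow> y \<in> U) uniformity)"

text \<open>Terms outside the support vanish. Enlarging the index set lets products with different
  first arguments be summed over a common set.\<close>

lemma inner_fin_seq_eq:
  assumes "finite A" "{n. coord x n \<noteq> 0} \<subseteq> A"
  shows "inner x y = (\<Sum>n\<in>A. coord x n * coord y n)"
  unfolding inner_fin_seq_def using assms by (intro sum.mono_neutral_left) auto

instance
proof
  fix x y z :: fin_seq and r :: real
  show "sgn x = x /\<^sub>R norm x" "dist x y = norm (x - y)" "norm x = sqrt (inner x x)"
    by (simp_all add: sgn_fin_seq_def dist_fin_seq_def norm_fin_seq_def)
  show "uniformity = (INF e\<in>{0<..}. principal {(x :: fin_seq, y). dist x y < e})"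
    by (rule uniformity_fin_seq_def)
  show "open U \<longleftrightarrow> (\<forall>x\<in>U. eventually (\<lambda>(x', y). x' = x \<longrightarrow> y \<in> U) uniformity)"
    for U :: "fin_seq set"
    by (rule open_fin_seq_def)
  define A where "A = {n. coord x n \<noteq> 0} \<union> {n. coord y n \<noteq> 0}"
  have A: "finite A" "{n. coord x n \<noteq> 0} \<subseteq> A" "{n. coord y n \<noteq> 0} \<subseteq> A"
    "{n. coord (x + y) n \<noteq> 0} \<subseteq> A" "{n. coord (r *\<^sub>R x) n \<noteq> 0} \<subseteq> A"
    by (auto simp: A_def plus_fin_seq.rep_eq scaleR_fin_seq.rep_eq)
  note inner_A = A(2-5)[THEN inner_fin_seq_eq[OF A(1)]]
  show "inner x y = inner y x"
    by (simp add: inner_A mult.commute)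
  show "inner (x + y) z = inner x z + inner y z"
    by (simp add: inner_A plus_fin_seq.rep_eq distrib_right sum.distrib)
  show "inner (r *\<^sub>R x) y = r * inner x y"
    by (simp add: inner_A scaleR_fin_seq.rep_eq sum_distrib_left mult.assoc)
  show "0 \<le> inner x x"
    by (simp add: inner_fin_seq_def sum_nonneg)
  have "inner x x = 0 \<longleftrightarrow> (\<forall>n. coord x n = 0)"
    by (auto simp: inner_fin_seq_def sum_nonneg_eq_0_iff)
  also have "\<dots> \<longleftrightarrow> x = 0"
    by (simp add: zero_fin_seq.rep_eq fun_eq_iff flip: coord_inject)
  finally show "inner x x = 0 \<longleftrightarrow> x = 0" .
qed

end

lift_definition basis_seq :: "nat \<Rightarrow> fin_seq" is "\<lambda>i n. of_bool (n = i)"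
  by simp

lemma inner_basis_seq: "inner (basis_seq i) (basis_seq j) = of_bool (i = j)"
proof -
  have "inner (basis_seq i) (basis_seq j) = (\<Sum>n\<in>{i}. coord (basis_seq i) n * coord (basis_seq j) n)"
    by (rule inner_fin_seq_eq) (auto simp: basis_seq.rep_eq)
  then show ?thesis
    by (simp add: basis_seq.rep_eq)
qed

section \<open>Orthonormal sequences and the long trapezoid property\<close>

lemma infinite_range_orthonormal:
  fixes e :: "nat \<Rightarrow> 'a::real_inner"
  assumes e: "\<And>i j. e i \<bullet> e j = of_bool (i = j)"
  shows "infinite (range e)"
proof -
  have "e i = e j \<longleftrightarrow> i = j" for i j
    using e[of i i] e[of i j] by auto
  then have "inj e" by (simp add: inj_def)
  then show ?thesis by (simp add: finite_image_iff)
qed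

text \<open>Distinct vectors of this set have inner product 0, except for the antipodal pair with
  -1. Writing the distance as a function F of the inner product treats the Euclidean and the
  hyperbolic metric alike.\<close>

lemma not_long_trapezoid_property_orthonormal:
  fixes e :: "nat \<Rightarrow> 'a::real_inner"
  assumes e: "\<And>i j. e i \<bullet> e j = of_bool (i = j)"
    and d: "\<And>x y. norm x = 1 \<Longrightarrow> norm y = 1 \<Longrightarrow> d x y = F (x \<bullet> y)"
    and F: "F 1 = 0" "0 < F 0" "F 0 < F (- 1)"
  shows "\<not> long_trapezoid_property (insert (- e 0) (range e)) d"
proof -
  have norm: "norm x = 1" if "x \<in> insert (- e 0) (range e)" for x
    using that by (auto simp: norm_eq_sqrt_inner e)
  have "- e 0 \<noteq> e 0"
  proof
    assume "- e 0 = e 0"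
    then have "(- e 0) \<bullet> e 0 = e 0 \<bullet> e 0"
      by simp
    then show False
      using e[of 0 0] unfolding inner_minus_left by simp
  qed
  show ?thesis
  proof (rule not_long_trapezoid_property_one_large_distance[of "- e 0" _ "e 0"])
    show "d (- e 0) (e 0) = F (- 1)" "d (e 0) (- e 0) = F (- 1)"
      by (simp_all add: d norm e)
    show "d x x = 0" if "x \<in> insert (- e 0) (range e)" for x
      using norm[OF that] by (simp add: d F dot_square_norm)
    show "d x y = F 0" if "x \<in> insert (- e 0) (range e)" "y \<in> insert (- e 0) (range e)"
      "x \<noteq> y" "{x, y} \<noteq> {- e 0, e 0}" for x y
    proof -
      have "x \<bullet> y = 0"
        using that by (auto simp: e)
      then show ?thesis
        using that norm by (simp add: d)
    qed
  qed (use F \<open>- e 0 \<noteq> e 0\<close> in auto)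
qed

lemma not_long_trapezoid_property_pullback:
  assumes g: "bij_betw g N M" and "\<not> long_trapezoid_property M d"
  shows "\<not> long_trapezoid_property N (\<lambda>x y. d (g x) (g y))"
proof
  define h where "h = inv_into N g"
  have gN: "g ` N = M" and inj: "inj_on g N"
    using g by (auto simp: bij_betw_def)
  have h: "h z \<in> N" "g (h z) = z" if "z \<in> M" for z
    using that gN by (auto simp: h_def inv_into_into f_inv_into_f)
  assume ltp: "long_trapezoid_property N (\<lambda>x y. d (g x) (g y))"
  have "\<exists>u\<in>M. \<exists>v\<in>M. u \<noteq> v \<and>
      (\<forall>x\<in>P. \<forall>y\<in>P. (1 - \<epsilon>) * (d x y + d u v) \<le> d x u + d y v)"
    if P: "finite P" "P \<subseteq> M" "0 < \<epsilon>" for P \<epsilon>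
  proof -
    have "finite (h ` P)" "h ` P \<subseteq> N"
      using P h by auto
    then have "\<exists>u\<in>N. \<exists>v\<in>N. u \<noteq> v \<and>
        (\<forall>x\<in>h ` P. \<forall>y\<in>h ` P.
          (1 - \<epsilon>) * (d (g x) (g y) + d (g u) (g v)) \<le> d (g x) (g u) + d (g y) (g v))"
      using ltp[unfolded long_trapezoid_property_def, rule_format, of "h ` P" \<epsilon>] \<open>0 < \<epsilon>\<close>
      by simp
    then obtain u v where uv: "u \<in> N" "v \<in> N" "u \<noteq> v"
      "\<forall>x\<in>h ` P. \<forall>y\<in>h ` P. (1 - \<epsilon>) * (d (g x) (g y) + d (g u) (g v)) \<le> d (g x) (g u) + d (g y) (g v)"
      by blast
    then have "\<forall>x\<in>P. \<forall>y\<in>P. (1 - \<epsilon>) * (d x y + d (g u) (g v)) \<le> d x (g u) + d y (g v)"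
      using P(2) h(2) by (auto simp: subset_iff)
    moreover have "g u \<noteq> g v"
      using uv inj by (simp add: inj_on_eq_iff)
    ultimately show ?thesis
      using uv(1,2) gN by blast
  qed
  then have "long_trapezoid_property M d"
    unfolding long_trapezoid_property_def by simp
  with assms(2) show False ..
qed

lemma exists_CAT_space_failing_LTP_nonpositive:
  assumes "\<kappa> \<le> 0"
  shows "\<exists>(d :: fin_seq \<Rightarrow> fin_seq \<Rightarrow> real) S.
    CAT_space \<kappa> UNIV d \<and> infinite S \<and> \<not> long_trapezoid_property S d"
proof -
  define S where "S = insert (- basis_seq 0) (range basis_seq)"
  have "infinite S"
    using infinite_range_orthonormal[OF inner_basis_seq] by (simp add: S_def)
  have "\<exists>d :: fin_seq \<Rightarrow> fin_seq \<Rightarrow> real. CAT_space \<kappa> UNIV d \<and> \<not> long_trapezoid_property S d"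
  proof (cases "\<kappa> = 0")
    case True
    \<comment> \<open>For unit vectors,
      \<open>(dist x y)\<^sup>2 = 2 - 2 * (x \<bullet> y)\<close>.\<close>
    define F :: "real \<Rightarrow> real" where "F t = sqrt (2 - 2 * t)" for t
    have "dist x y = F (x \<bullet> y)" if "norm x = 1" "norm y = 1" for x y :: fin_seq
    proof -
      have "x \<bullet> x = 1" "y \<bullet> y = 1"
        using that by (simp_all add: dot_square_norm)
      then show ?thesis
        by (simp add: F_def dist_norm norm_eq_sqrt_inner inner_simps inner_commute)
    qed
    moreover have "F 1 = 0" "0 < F 0" "F 0 < F (- 1)"
      by (simp_all add: F_def sqrt2_less_2)
    ultimately have "\<not> long_trapezoid_property S dist"
      unfolding S_def by (rule not_long_trapezoid_property_orthonormal[OF inner_basis_seq])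
    moreover have "CAT_space \<kappa> (UNIV :: fin_seq set) dist"
      using True CAT_space_real_inner by simp
    ultimately show ?thesis
      by (intro exI conjI)
  next
    case False
    \<comment> \<open>The lift of a unit vector has last coordinate sqrt 2, so the product of two
      lifts is \<open>2 - x \<bullet> y\<close>.\<close>
    define F where "F t = arcosh (2 - t) / sqrt (- \<kappa>)" for t
    have "hyp_dist (sqrt (- \<kappa>)) x y = F (x \<bullet> y)" if "norm x = 1" "norm y = 1" for x y :: fin_seq
      using that by (simp add: hyp_dist_def F_def mink_def hyp_lift_def dot_square_norm)
    moreover have "F 1 = 0" "0 < F 0" "F 0 < F (- 1)"
      using False assms by (simp_all add: F_def divide_strict_right_mono)
    ultimately have "\<not> long_trapezoid_property S (hyp_dist (sqrt (- \<kappa>)))"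
      unfolding S_def by (rule not_long_trapezoid_property_orthonormal[OF inner_basis_seq])
    moreover have "CAT_space \<kappa> (UNIV :: fin_seq set) (hyp_dist (sqrt (- \<kappa>)))"
      using False assms by (intro CAT_space_hyp_dist) simp
    ultimately show ?thesis
      by (intro exI conjI)
  qed
  with \<open>infinite S\<close> show ?thesis
    by blast
qed

theorem mainTheorem10:
  fixes \<kappa> :: real
  shows "\<exists>(M :: (nat \<Rightarrow> real) set) d S.
    CAT_space \<kappa> M d \<and> S \<subseteq> M \<and> infinite S \<and> \<not> long_trapezoid_property S d"
proof (cases "\<kappa> > 0")
  case True
  have "infinite (UNIV :: (nat \<Rightarrow> real) set)"
    by (simp add: finite_UNIV_fun infinite_UNIV_char_0)
  then show ?thesis
    using exists_CAT_space_failing_LTP_positive[OF True] by blast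
next
  case False
  then obtain d :: "fin_seq \<Rightarrow> fin_seq \<Rightarrow> real" and S
    where d: "CAT_space \<kappa> UNIV d" "infinite S" "\<not> long_trapezoid_property S d"
    using exists_CAT_space_failing_LTP_nonpositive[of \<kappa>] by auto
  \<comment> \<open>On \<open>range coord\<close> this inverts the embedding of
    \<open>fin_seq\<close> into functions; the metric is carried over along it.\<close>
  define g where "g = inv coord"
  have inj: "inj coord"
    by (simp add: inj_def coord_inject)
  then have bij: "bij_betw g (coord ` X) X" for X
    by (auto simp: g_def bij_betw_def inj_on_def image_image)
  have "infinite (coord ` S)"
    using d(2) inj by (simp add: finite_image_iff inj_on_subset)
  moreover have "CAT_space \<kappa> (range coord) (\<lambda>x y. d (g x) (g y))"
    by (rule CAT_space_pullback[OF bij d(1)])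
  moreover have "\<not> long_trapezoid_property (coord ` S) (\<lambda>x y. d (g x) (g y))"
    by (rule not_long_trapezoid_property_pullback[OF bij d(3)])
  moreover have "coord ` S \<subseteq> range coord"
    by blast
  ultimately show ?thesis
    by blast
qed

end
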